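(* Let $K,N\ge1$ be integers with $K$ dividing $N$, and consider the data shuffling problem with $N$ files, a master node and $K$ worker nodes, each with a cache of size $S$ files, and put $\widehat S=S/(N/K)$. For every integer $\widehat S\in[K]$, the delivery load $$\rho(\widehat S)=\frac NK\,\frac{\binom{K-1}{\widehat S}}{\binom{K-1}{\widehat S-1}}$$ is achievable for every file transition graph; that is, the constant family $\rho_d=\rho(\widehat S)$ ($d$ ranging over all assignments) is achievable with cache size $S$. For non-integer $\widehat S$ with $1\le\widehat S\le K$, the value at $\widehat S$ of the lower convex envelope of the $K$ corner points $(s,\rho(s))$, $s\in[K]$, is achievable in the same sense.
   Context: Notation: $[K]=\{1,\dots,K\}$; $\binom{n}{k}=0$ when $n<k$. Data shuffling problem ($K\mid N$, so $N\ge K$). There are $N$ files $F^1,\dots,F^N$, each a string of $B$ bits ($B$ a positive integer; the files are independent and uniformly distributed); the size of a file is normalized to $1$, i.e. sizes are measured in units of $B$ bits. There are $K$ worker nodes $W_1,\dots,W_K$ and a master node that knows all files. At iteration $t$ worker $W_i$ processes, and stores completely, the $N/K$ files with indices in $u(i)=\{(i-1)N/K+\ell:\ell\in[N/K]\}$. Each worker has a cache of size $S$ files, $N/K\le S\le N$ real. An uncoded placement (with cache size $S$, file length $B$) specifies for each worker $W_i$ and each file $F^j$ with $j\notin u(i)$ a set of bits (bit positions) of $F^j$ stored in the excess storage of $W_i$, with at most $(S-N/K)B$ excess bits in total for each worker. The cache content $\mathcal Z_i$ consists of the files in $u(i)$ and the excess bits. The placement is chosen without knowledge of the next assignment. An assignment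 $d$ is an ordered partition $(d(1),\dots,d(K))$ of $[N]$ into blocks of size $N/K$: at iteration $t+1$ worker $W_i$ must process the files with indices in $d(i)$. A delivery for $d$ of load $L/B$ is a function $\mathcal X$ of all files with values in $\{0,1\}^L$ (broadcast by the master to all workers without error) such that for each $i\in[K]$ all files $F^j$, $j\in d(i)$, are functions of $(\mathcal X,\mathcal Z_i)$. The file transition graph of $d$ is the directed multigraph on the workers with one edge per file, the edge of $F^j$ going from $W_i$ to $W_\ell$ where $j\in u(i)\cap d(\ell)$; any such graph arises from some assignment $d$. A family of loads $(\rho_d)_d$, indexed by all assignments $d$, is achievable with cache size $S$ if for every $\varepsilon>0$ there exist $B$ and one single uncoded placement (independent of $d$) such that for every $d$ there is a delivery for $d$ of load at most $\rho_d+\varepsilon$. *)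

theory Defs
  imports "HOL-Analysis.Analysis"
begin

text \<open>Files are indexed by \<open>{1..N}\<close> and workers by \<open>{1..K}\<close>; bit positions of a file of
  \<open>B\<close> bits are \<open>{..<B}\<close>. Throughout, \<open>K dvd N\<close> is intended.\<close>

definition init_files :: "nat \<Rightarrow> nat \<Rightarrow> nat \<Rightarrow> nat set" where
  "init_files K N i = {(i - 1) * (N div K) + l | l. l \<in> {1..N div K}}"

definition file_libraries :: "nat \<Rightarrow> nat \<Rightarrow> (nat \<Rightarrow> bool list) set" where
  "file_libraries N B = {1..N} \<rightarrow>\<^sub>E {w. length w = B}"

text \<open>\<open>P i j\<close> is the set of bit positions of file \<open>j\<close> in the excess storage of worker \<open>i\<close>;
  it is meaningful only for \<open>j\<close> outside \<open>init_files K N i\<close>.\<close>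

definition uncoded_placement ::
  "nat \<Rightarrow> nat \<Rightarrow> real \<Rightarrow> nat \<Rightarrow> (nat \<Rightarrow> nat \<Rightarrow> nat set) \<Rightarrow> bool" where
  "uncoded_placement K N S B P \<longleftrightarrow>
     (\<forall>i\<in>{1..K}. (\<forall>j\<in>{1..N} - init_files K N i. P i j \<subseteq> {..<B}) \<and>
        real (\<Sum>j\<in>{1..N} - init_files K N i. card (P i j)) \<le> (S - real N / real K) * real B)"

definition cache_content ::
  "nat \<Rightarrow> nat \<Rightarrow> (nat \<Rightarrow> nat \<Rightarrow> nat set) \<Rightarrow> nat \<Rightarrow> (nat \<Rightarrow> bool list) \<Rightarrow>
     (nat \<Rightarrow> bool list) \<times> (nat \<Rightarrow> nat \<Rightarrow> bool)" where
  "cache_content K N P i F =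
     (restrict F (init_files K N i),
      \<lambda>j\<in>{1..N} - init_files K N i. \<lambda>b\<in>P i j. F j ! b)"

text \<open>Assignments are extensional functions, so that a family of loads indexed by
  assignments has exactly one value for each ordered partition.\<close>

definition assignments :: "nat \<Rightarrow> nat \<Rightarrow> (nat \<Rightarrow> nat set) set" where
  "assignments K N =
     {d \<in> {1..K} \<rightarrow>\<^sub>E Pow {1..N}.
        disjoint_family_on d {1..K} \<and> (\<Union>i\<in>{1..K}. d i) = {1..N} \<and>
        (\<forall>i\<in>{1..K}. card (d i) = N div K)}"

text \<open>The decoder \<open>\<psi>\<close> may depend on everything except the file contents. As the files are
  uniformly distributed, being a function of the broadcast and the cache content
  is a condition on all file contents.\<close>

definition is_delivery ::
  "nat \<Rightarrow> nat \<Rightarrow> nat \<Rightarrow> (nat \<Rightarrow> nat \<Rightarrow> nat set) \<Rightarrow> (nat \<Rightarrow> nat set) \<Rightarrow> nat \<Rightarrow>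
     ((nat \<Rightarrow> bool list) \<Rightarrow> bool list) \<Rightarrow> bool" where
  "is_delivery K N B P d L X \<longleftrightarrow>
     X \<in> file_libraries N B \<rightarrow> {w. length w = L} \<and>
     (\<forall>i\<in>{1..K}. \<forall>j\<in>d i. \<exists>\<psi>. \<forall>F\<in>file_libraries N B.
        F j = \<psi> (X F) (cache_content K N P i F))"

definition achievable ::
  "nat \<Rightarrow> nat \<Rightarrow> real \<Rightarrow> ((nat \<Rightarrow> nat set) \<Rightarrow> real) \<Rightarrow> bool" where
  "achievable K N S \<rho> \<longleftrightarrow>
     (\<forall>\<epsilon>>0. \<exists>B>0. \<exists>P. uncoded_placement K N S B P \<and>
        (\<forall>d\<in>assignments K N. \<exists>L X. is_delivery K N B P d L X \<and>
           real L / real B \<le> \<rho> d + \<epsilon>))"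

definition corner_load :: "nat \<Rightarrow> nat \<Rightarrow> nat \<Rightarrow> real" where
  "corner_load K N s =
     real N / real K * (real ((K - 1) choose s) / real ((K - 1) choose (s - 1)))"

text \<open>Only meaningful for \<open>x\<close> in the projection of the convex hull of a bounded set \<open>C\<close>.\<close>

definition lower_convex_envelope :: "(real \<times> real) set \<Rightarrow> real \<Rightarrow> real" where
  "lower_convex_envelope C x = Inf {y. (x, y) \<in> convex hull C}"

end

theory Submission
  imports Defs "HOL-Library.Z2"
begin

text \<open>At a corner point \<open>s\<close>, every file is split into subfiles indexed by the \<open>(s - 1)\<close>-sets of workers
  other than its owner, and each such set caches its subfile. Serve one requested file per worker
  at a time. For every \<open>(s + 1)\<close>-set \<open>D\<close> of workers let \<open>Y D\<close> be the sum (mod 2) of the subfiles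
  wanted by one member of \<open>D\<close> and cached by all others. The master sends the simplicial boundary
  of \<open>Y\<close>, but only on the \<open>s\<close>-sets avoiding worker \<open>K\<close>: since the boundary of a boundary
  vanishes, the other values follow. From its value on \<open>G \<union> {l}\<close>, worker \<open>l\<close> recovers
  the wanted subfile \<open>G\<close>, because all other summands are in its cache. It is not needed that the
  files served simultaneously have distinct owners, so the transition graph need not be decomposed into
  permutations. The remaining points of the convex hull follow by concatenating copies of the
  corner schemes.\<close>

section \<open>Sums mod 2, the simplicial boundary and decoding from it\<close>

lemma bit_add_self: "x + x = (0::bit)"
  by (metis bit_2_eq_0 mult_2 mult_zero_left)

text \<open>Every unordered pair contributes twice, hence nothing mod 2.\<close>

lemma sum_pairs_symmetric_bit:
  fixes h :: "'a \<Rightarrow> 'a \<Rightarrow> bit"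
  assumes "finite A" and sym: "\<And>x y. h x y = h y x"
  shows "(\<Sum>x\<in>A. \<Sum>y\<in>A - {x}. h x y) = 0"
  using assms(1)
proof (induction A)
  case (insert a A)
  have *: "(\<Sum>y\<in>insert a A - {x}. h x y) = h x a + (\<Sum>y\<in>A - {x}. h x y)" if "x \<in> A" for x
  proof -
    have "insert a A - {x} = insert a (A - {x})" using insert.hyps that by auto
    then show ?thesis using insert.hyps by simp
  qed
  have "(\<Sum>x\<in>insert a A. \<Sum>y\<in>insert a A - {x}. h x y)
      = (\<Sum>y\<in>A. h a y) + (\<Sum>x\<in>A. h x a + (\<Sum>y\<in>A - {x}. h x y))"
    using insert.hyps * by (simp cong: sum.cong)
  also have "\<dots> = (\<Sum>y\<in>A. h a y) + (\<Sum>y\<in>A. h a y)"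
    by (simp only: sum.distrib insert.IH sym[of _ a]) simp
  finally show ?case by (simp only: bit_add_self)
qed simp

text \<open>Cancellation solves for the one unknown summand; both decoding lemmas below rest on
  it.\<close>

lemma sum_eq_imp_remaining_eq:
  fixes f g :: "'a \<Rightarrow> 'b::cancel_comm_monoid_add"
  assumes "finite A" "a \<in> A" "sum f A = sum g A" "\<And>x. x \<in> A - {a} \<Longrightarrow> f x = g x"
  shows "f a = g a"
proof -
  have "f a + sum f (A - {a}) = g a + sum f (A - {a})"
    using assms sum.remove[of A a f] sum.remove[of A a g] sum.cong[of "A - {a}" "A - {a}" f g]
    by metis
  then show ?thesis by simp
qed

text \<open>\<open>Y\<close> lists the coefficients of a chain on the vertex set \<open>V\<close>;
  this is the coefficient of its simplicial boundary at the face \<open>D\<close>, and mod 2 there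
  are no signs.\<close>

definition boundary :: "'a set \<Rightarrow> ('a set \<Rightarrow> bit) \<Rightarrow> 'a set \<Rightarrow> bit" where
  "boundary V Y D = (\<Sum>k\<in>V - D. Y (insert k D))"

text \<open>Adding two vertices in either order gives the same set, so the terms cancel in
  pairs.\<close>

lemma boundary_boundary:
  assumes "finite V"
  shows "boundary V (boundary V Y) D = 0"
proof -
  have "V - insert k D = V - D - {k}" for k by auto
  then show ?thesis
    unfolding boundary_def
    using sum_pairs_symmetric_bit[of "V - D" "\<lambda>k k'. Y (insert k' (insert k D))"] assms
    by (simp add: insert_commute)
qed

text \<open>The boundary of the boundary vanishes at \<open>D - {a}\<close>. In that relation
  \<open>D\<close> is the only set containing \<open>a\<close>, so its value follows from the sets
  avoiding \<open>a\<close>. This lowers the number of broadcast sums from \<open>K choose s\<close>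
  to \<open>(K - 1) choose s\<close>.\<close>

lemma boundary_eqI:
  assumes "finite V" "a \<in> V" "D \<subseteq> V" "card D = s"
    and eq: "\<And>D. D \<subseteq> V - {a} \<Longrightarrow> card D = s \<Longrightarrow> boundary V Y D = boundary V Y' D"
  shows "boundary V Y D = boundary V Y' D"
proof (cases "a \<in> D")
  case False
  then show ?thesis using assms by (intro eq) auto
next
  case True
  define T where "T = D - {a}"
  have fin: "finite D" using assms finite_subset by blast
  have D: "D = insert a T" "a \<notin> T" using True by (auto simp: T_def)
  show ?thesis
    unfolding D(1)
  proof (rule sum_eq_imp_remaining_eq[where A = "V - T" and a = a])
    show "(\<Sum>k\<in>V - T. boundary V Y (insert k T)) = (\<Sum>k\<in>V - T. boundary V Y' (insert k T))"
      using boundary_boundary[OF assms(1), of _ T] by (simp add: boundary_def)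
    fix k assume "k \<in> V - T - {a}"
    moreover have "finite T" using fin by (simp add: T_def)
    then have "card (insert k T) = card D" if "k \<notin> T"
      using that D(2) by (simp add: D(1))
    ultimately show "boundary V Y (insert k T) = boundary V Y' (insert k T)"
      using assms by (intro eq) (auto simp: T_def)
  qed (use assms D in auto)
qed

text \<open>Worker \<open>m\<close> requests file \<open>f m\<close>, and \<open>v j G\<close> is the subfile of file \<open>j\<close> cached exactly by
  the owner of \<open>j\<close> and the workers in \<open>G\<close>. Every summand is requested by one worker in \<open>D\<close> and
  cached by all others.\<close>

definition multicast ::
  "('b \<Rightarrow> 'a) \<Rightarrow> ('a \<Rightarrow> 'b) \<Rightarrow> ('b \<Rightarrow> 'a set \<Rightarrow> bit) \<Rightarrow> 'a set \<Rightarrow> bit" where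
  "multicast own f v D =
     (\<Sum>m\<in>D. if own (f m) \<in> D - {m} then v (f m) (D - {m, own (f m)}) else 0)"

text \<open>\<open>v\<close> and \<open>w\<close> are the subfiles of two libraries that worker
  \<open>l\<close> has to tell apart: decodability means that agreement on the broadcast and on the
  cache forces agreement on the wanted subfile. The wanted subfile occurs in a single term of the
  double sum, and all other nonzero terms are cached by \<open>l\<close>.\<close>

lemma boundary_multicast_decode:
  assumes "finite V" "l \<in> V" and own: "own (f l) \<in> V" "own (f l) \<noteq> l"
    and G: "G \<subseteq> V - {own (f l)}" "l \<notin> G"
    and eq: "boundary V (multicast own f v) (insert l G) = boundary V (multicast own f w) (insert l G)"
    and known: "\<And>m G'. \<lbrakk>m \<in> V; G' \<subseteq> V - {own (f m)}; card G' = card G; own (f m) = l \<or> l \<in> G'\<rbrakk>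
      \<Longrightarrow> v (f m) G' = w (f m) G'"
  shows "v (f l) G = w (f l) G"
proof -
  let ?D = "\<lambda>k. insert k (insert l G)"
  let ?t = "\<lambda>v k m. if own (f m) \<in> ?D k - {m} then v (f m) (?D k - {m, own (f m)}) else 0"
  have fin: "finite G" using assms finite_subset by blast
  \<comment> \<open>Since \<open>l\<close> lies in \<open>?D k\<close> and differs from
    \<open>m\<close>, it is either the owner of \<open>f m\<close> or a member of the index set left
    after removing \<open>m\<close> and the owner; in both cases it has the subfile.\<close>
  have others: "?t v k m = ?t w k m" if k: "k \<in> V - insert l G" and m: "m \<in> ?D k" "m \<noteq> l" for k m
  proof (cases "own (f m) \<in> ?D k - {m}")
    case True
    have "card (?D k - {m, own (f m)}) = card (?D k) - card {m, own (f m)}"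
      using m True fin by (intro card_Diff_subset) auto
    also have "\<dots> = card G" using k G True fin by auto
    finally have "card (?D k - {m, own (f m)}) = card G" .
    then have "v (f m) (?D k - {m, own (f m)}) = w (f m) (?D k - {m, own (f m)})"
      using m k G assms(2) by (intro known) auto
    then show ?thesis by simp
  next
    case False
    then show ?thesis by (simp only: if_False)
  qed
  \<comment> \<open>For every other \<open>k\<close> the set \<open>?D k\<close> misses the owner of
    \<open>f l\<close>, so the term of \<open>l\<close> itself is zero there.\<close>
  have "multicast own f v (?D (own (f l))) = multicast own f w (?D (own (f l)))"
  proof (rule sum_eq_imp_remaining_eq[where A = "V - insert l G" and a = "own (f l)"])
    show "(\<Sum>k\<in>V - insert l G. multicast own f v (?D k)) = (\<Sum>k\<in>V - insert l G. multicast own f w (?D k))"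
      using eq by (simp only: boundary_def)
    fix k assume k: "k \<in> V - insert l G - {own (f l)}"
    have "?t v k m = ?t w k m" if "m \<in> ?D k" for m
    proof (cases "m = l")
      case True
      then have "own (f m) \<notin> ?D k - {m}" using k G own by auto
      then show ?thesis by (simp only: if_False)
    qed (use k others that in blast)
    then show "multicast own f v (?D k) = multicast own f w (?D k)"
      unfolding multicast_def by (intro sum.cong) auto
  qed (use assms in auto)
  then have "?t v (own (f l)) l = ?t w (own (f l)) l"
    unfolding multicast_def
  proof (rule sum_eq_imp_remaining_eq[rotated 2])
    fix m assume "m \<in> ?D (own (f l)) - {l}"
    then show "?t v (own (f l)) m = ?t w (own (f l)) m" using own G by (intro others) auto
  qed (use fin in auto)
  moreover have "?D (own (f l)) - {l, own (f l)} = G" using G by auto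
  ultimately show ?thesis using own by simp
qed

section \<open>Counting subsets, owners of files, and decodability\<close>

text \<open>Removing \<open>i\<close> leaves an arbitrary \<open>(r - 1)\<close>-subset of
  \<open>A - {i}\<close>; the absorption identity does the rest. The product form also covers
  \<open>r = 0\<close>. It measures how much of a file a worker caches.\<close>

lemma card_subsets_containing:
  assumes "finite A" "i \<in> A"
  shows "card {G. G \<subseteq> A \<and> card G = r \<and> i \<in> G} * card A = r * (card A choose r)"
proof (cases r)
  case 0
  have "card G \<noteq> 0" if "G \<subseteq> A" "i \<in> G" for G
    using that finite_subset[OF that(1) assms(1)] by auto
  then have "{G. G \<subseteq> A \<and> card G = r \<and> i \<in> G} = {}" using 0 by blast
  then show ?thesis using 0 by (simp only: card.empty)
next
  case (Suc k)
  have "bij_betw (insert i) {G. G \<subseteq> A - {i} \<and> card G = k} {G. G \<subseteq> A \<and> card G = r \<and> i \<in> G}"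
  proof (rule bij_betwI[where g = "\<lambda>G. G - {i}"])
    show "insert i \<in> {G. G \<subseteq> A - {i} \<and> card G = k} \<rightarrow> {G. G \<subseteq> A \<and> card G = r \<and> i \<in> G}"
    proof
      fix G assume G: "G \<in> {G. G \<subseteq> A - {i} \<and> card G = k}"
      then have "finite G" using assms(1) finite_subset by blast
      moreover have "i \<notin> G" using G by auto
      ultimately show "insert i G \<in> {G. G \<subseteq> A \<and> card G = r \<and> i \<in> G}"
        using G assms Suc by auto
    qed
  qed (use assms Suc in auto)
  then have "card {G. G \<subseteq> A \<and> card G = r \<and> i \<in> G} = (card A - 1) choose k"
    using n_subsets[of "A - {i}" k] assms by (simp add: bij_betw_same_card[symmetric])
  then show ?thesis
    using binomial_absorption[of k "card A"] Suc by (simp add: mult.commute)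
qed

definition file_owner :: "nat \<Rightarrow> nat \<Rightarrow> nat \<Rightarrow> nat" where
  "file_owner K N j = (j - 1) div (N div K) + 1"

lemma init_files_eq:
  assumes "K dvd N" "N \<ge> 1" "i \<in> {1..K}"
  shows "init_files K N i = {j \<in> {1..N}. file_owner K N j = i}"
proof -
  obtain q where N: "N = K * q" using assms(1) by blast
  have q: "N div K = q" "q > 0" using N assms by auto
  obtain i' where i: "i = Suc i'" "i' < K" using assms(3) by (cases i) auto
  have owner: "(i' * q + l - 1) div q = i'" if "l \<in> {1..q}" for l
  proof -
    have "i' * q + l - 1 = (l - 1) + i' * q" using that by simp
    moreover have "l - 1 < q" using that by auto
    ultimately show ?thesis by simp
  qed
  have le: "i' * q + l \<le> N" if "l \<in> {1..q}" for l
  proof -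
    have "i' * q + l \<le> Suc i' * q" using that by simp
    also have "\<dots> \<le> K * q" using i by (intro mult_right_mono) auto
    finally show ?thesis using N by simp
  qed
  have ex: "\<exists>l\<in>{1..q}. j = i' * q + l" if "j \<ge> 1" "(j - 1) div q = i'" for j
  proof
    show "j = i' * q + (1 + (j - 1) mod q)"
      using that div_mult_mod_eq[of "j - 1" q] by simp
  qed (use q in \<open>auto simp: Suc_le_eq\<close>)
  have "(\<exists>l\<in>{1..q}. j = i' * q + l) \<longleftrightarrow> j \<in> {1..N} \<and> (j - 1) div q = i'" for j
  proof
    assume "\<exists>l\<in>{1..q}. j = i' * q + l"
    then obtain l where l: "l \<in> {1..q}" "j = i' * q + l" by blast
    then show "j \<in> {1..N} \<and> (j - 1) div q = i'" using owner[OF l(1)] le[OF l(1)] by simp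
  next
    assume "j \<in> {1..N} \<and> (j - 1) div q = i'"
    then show "\<exists>l\<in>{1..q}. j = i' * q + l" by (intro ex) auto
  qed
  moreover have "j \<in> init_files K N i \<longleftrightarrow> (\<exists>l\<in>{1..q}. j = i' * q + l)" for j
    unfolding init_files_def q(1) i(1) diff_Suc_1 by blast
  moreover have "file_owner K N j = i \<longleftrightarrow> (j - 1) div q = i'" for j
    using q i by (simp add: file_owner_def)
  ultimately show ?thesis by blast
qed

lemma card_init_files: "card (init_files K N i) = N div K"
proof -
  have "init_files K N i = (\<lambda>l. (i - 1) * (N div K) + l) ` {1..N div K}"
    unfolding init_files_def by blast
  then show ?thesis by (simp add: card_image)
qed

lemma file_owner_bounds:
  assumes "K dvd N" "N \<ge> 1" "j \<in> {1..N}"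
  shows "file_owner K N j \<in> {1..K}"
proof -
  obtain q where N: "N = K * q" using assms(1) by blast
  have "j - 1 < K * q" using N assms by auto
  then have "(j - 1) div q < K" by (simp add: less_mult_imp_div_less)
  then show ?thesis using N assms by (auto simp: file_owner_def)
qed

lemma cache_content_eq_iff:
  "cache_content K N P i F = cache_content K N P i F' \<longleftrightarrow>
     (\<forall>j\<in>init_files K N i. F j = F' j) \<and>
     (\<forall>j\<in>{1..N} - init_files K N i. \<forall>b\<in>P i j. F j ! b = F' j ! b)"
  unfolding cache_content_def by (auto simp: restrict_def fun_eq_iff)

text \<open>A quantity is a function of the observed data iff it is constant wherever these agree;
  the decoder picks any library consistent with the data. Later proofs compare two libraries and
  construct no decoders.\<close>

lemma is_delivery_iff:
  "is_delivery K N B P d L X \<longleftrightarrow>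
     X \<in> file_libraries N B \<rightarrow> {w. length w = L} \<and>
     (\<forall>i\<in>{1..K}. \<forall>j\<in>d i. \<forall>F\<in>file_libraries N B. \<forall>F'\<in>file_libraries N B.
        X F = X F' \<longrightarrow> cache_content K N P i F = cache_content K N P i F' \<longrightarrow> F j = F' j)"
proof -
  have "(\<exists>\<psi>. \<forall>F\<in>A. F j = \<psi> (X F) (Z F)) \<longleftrightarrow>
      (\<forall>F\<in>A. \<forall>F'\<in>A. X F = X F' \<longrightarrow> Z F = Z F' \<longrightarrow> F j = F' j)"
    for A and Z :: "(nat \<Rightarrow> bool list) \<Rightarrow> (nat \<Rightarrow> bool list) \<times> (nat \<Rightarrow> nat \<Rightarrow> bool)" and j :: nat
  proof
    assume *: "\<forall>F\<in>A. \<forall>F'\<in>A. X F = X F' \<longrightarrow> Z F = Z F' \<longrightarrow> F j = F' j"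
    let ?F = "\<lambda>x z. SOME F. F \<in> A \<and> X F = x \<and> Z F = z"
    have "F j = ?F (X F) (Z F) j" if "F \<in> A" for F
    proof -
      have "?F (X F) (Z F) \<in> A \<and> X (?F (X F) (Z F)) = X F \<and> Z (?F (X F) (Z F)) = Z F"
        by (rule someI[of _ F]) (use that in simp)
      then show ?thesis using *[rule_format, OF that, of "?F (X F) (Z F)"] by simp
    qed
    then show "\<exists>\<psi>. \<forall>F\<in>A. F j = \<psi> (X F) (Z F)"
      by (intro exI[of _ "\<lambda>x z. ?F x z j"] ballI)
  qed metis
  then show ?thesis unfolding is_delivery_def by simp
qed

section \<open>Schemes with integer parameters and their concatenation\<close>

text \<open>File length \<open>B\<close>, excess bits \<open>A\<close> per worker and broadcast
  length \<open>L\<close> are kept as separate integers because all three add up under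
  concatenation. \<open>B = 0\<close> is allowed as the neutral element, and one \<open>L\<close>
  serves all assignments.\<close>

definition shuffling_scheme :: "nat \<Rightarrow> nat \<Rightarrow> nat \<Rightarrow> nat \<Rightarrow> nat \<Rightarrow> bool" where
  "shuffling_scheme K N B A L \<longleftrightarrow>
     (\<exists>P. (\<forall>i\<in>{1..K}. (\<forall>j\<in>{1..N} - init_files K N i. P i j \<subseteq> {..<B}) \<and>
            (\<Sum>j\<in>{1..N} - init_files K N i. card (P i j)) \<le> A) \<and>
          (\<forall>d\<in>assignments K N. \<exists>X. is_delivery K N B P d L X))"

lemma shuffling_scheme_0: "shuffling_scheme K N 0 0 0"
proof -
  have "F j = F' j"
    if "d \<in> assignments K N" "i \<in> {1..K}" "j \<in> d i"
      "F \<in> file_libraries N 0" "F' \<in> file_libraries N 0" for d i j F F'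
  proof -
    have "j \<in> {1..N}" using that by (auto simp: assignments_def PiE_def Pi_def)
    then show ?thesis using that by (auto simp: file_libraries_def PiE_iff)
  qed
  then show ?thesis
    unfolding shuffling_scheme_def is_delivery_iff
    by (intro exI[of _ "\<lambda>_ _. {}"] conjI ballI exI[of _ "\<lambda>_. []"]) auto
qed

text \<open>The first scheme runs on the first \<open>B\<close> bits of every file, the second on
  the remaining \<open>B'\<close> bits, and the two broadcasts are sent one after the other.\<close>

lemma shuffling_scheme_add:
  assumes "shuffling_scheme K N B A L" "shuffling_scheme K N B' A' L'"
  shows "shuffling_scheme K N (B + B') (A + A') (L + L')"
proof -
  obtain P where
    P: "\<And>i j. i \<in> {1..K} \<Longrightarrow> j \<in> {1..N} - init_files K N i \<Longrightarrow> P i j \<subseteq> {..<B}"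
      "\<And>i. i \<in> {1..K} \<Longrightarrow> (\<Sum>j\<in>{1..N} - init_files K N i. card (P i j)) \<le> A"
    and X: "\<And>d. d \<in> assignments K N \<Longrightarrow> \<exists>X. is_delivery K N B P d L X"
    using assms(1) unfolding shuffling_scheme_def by blast
  obtain P' where
    P': "\<And>i j. i \<in> {1..K} \<Longrightarrow> j \<in> {1..N} - init_files K N i \<Longrightarrow> P' i j \<subseteq> {..<B'}"
      "\<And>i. i \<in> {1..K} \<Longrightarrow> (\<Sum>j\<in>{1..N} - init_files K N i. card (P' i j)) \<le> A'"
    and X': "\<And>d. d \<in> assignments K N \<Longrightarrow> \<exists>X. is_delivery K N B' P' d L' X"
    using assms(2) unfolding shuffling_scheme_def by blast
  define Q where "Q i j = P i j \<union> (+) B ` P' i j" for i j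
  define left where "left F = (\<lambda>j\<in>{1..N}. take B (F j))" for F :: "nat \<Rightarrow> bool list"
  define right where "right F = (\<lambda>j\<in>{1..N}. drop B (F j))" for F :: "nat \<Rightarrow> bool list"
  have lib: "left F \<in> file_libraries N B" "right F \<in> file_libraries N B'"
    if "F \<in> file_libraries N (B + B')" for F
    using that by (auto simp: left_def right_def file_libraries_def PiE_iff)
  have card: "(\<Sum>j\<in>{1..N} - init_files K N i. card (Q i j)) \<le> A + A'" if "i \<in> {1..K}" for i
  proof -
    have "card (Q i j) \<le> card (P i j) + card (P' i j)" for j
      unfolding Q_def using card_Un_le[of "P i j" "(+) B ` P' i j"] by (simp add: card_image)
    then have "(\<Sum>j\<in>{1..N} - init_files K N i. card (Q i j)) \<le>
        (\<Sum>j\<in>{1..N} - init_files K N i. card (P i j) + card (P' i j))"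
      by (rule sum_mono)
    also have "\<dots> \<le> A + A'"
      using P(2)[OF that] P'(2)[OF that] by (simp add: sum.distrib)
    finally show ?thesis .
  qed
  have "\<exists>X. is_delivery K N (B + B') Q d (L + L') X" if d: "d \<in> assignments K N" for d
  proof -
    obtain X where X: "is_delivery K N B P d L X" using X d by blast
    obtain X' where X': "is_delivery K N B' P' d L' X'" using X' d by blast
    have len: "length (X (left F)) = L" "length (X' (right F)) = L'"
      if "F \<in> file_libraries N (B + B')" for F
      using X X' lib[OF that] unfolding is_delivery_def by auto
    have "F j = F' j"
      if i: "i \<in> {1..K}" "j \<in> d i"
        and F: "F \<in> file_libraries N (B + B')" "F' \<in> file_libraries N (B + B')"
        and eq: "X (left F) @ X' (right F) = X (left F') @ X' (right F')"
        and cache: "cache_content K N Q i F = cache_content K N Q i F'" for i j F F'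
    proof -
      have j: "j \<in> {1..N}" using d i by (auto simp: assignments_def PiE_def Pi_def)
      have len_F: "length (F j) = B + B'" "length (F' j) = B + B'" if "j \<in> {1..N}" for j
        using F that by (auto simp: file_libraries_def PiE_iff)
      have owned: "F j = F' j" if "j \<in> init_files K N i" for j
        using cache that by (auto simp: cache_content_eq_iff)
      have excess: "F j ! b = F' j ! b" if "j \<in> {1..N} - init_files K N i" "b \<in> Q i j" for j b
        using cache that by (auto simp: cache_content_eq_iff)
      have "cache_content K N P i (left F) = cache_content K N P i (left F')"
        unfolding cache_content_eq_iff
      proof (intro conjI ballI)
        fix j assume "j \<in> init_files K N i"
        then show "left F j = left F' j" using owned by (simp add: left_def restrict_def)
      next
        fix j b assume j: "j \<in> {1..N} - init_files K N i" and b: "b \<in> P i j"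
        then have "b < B" using P(1) i by blast
        then show "left F j ! b = left F' j ! b"
          using excess[OF j, of b] j b by (simp add: left_def Q_def)
      qed
      \<comment> \<open>The first message always has length \<open>L\<close>, so the concatenation
        splits uniquely.\<close>
      moreover have "X (left F) = X (left F')" "X' (right F) = X' (right F')"
        using eq len F by auto
      moreover have "cache_content K N P' i (right F) = cache_content K N P' i (right F')"
        unfolding cache_content_eq_iff
      proof (intro conjI ballI)
        fix j assume "j \<in> init_files K N i"
        then show "right F j = right F' j" using owned by (simp add: right_def restrict_def)
      next
        fix j b assume j: "j \<in> {1..N} - init_files K N i" and b: "b \<in> P' i j"
        then show "right F j ! b = right F' j ! b"
          using excess[OF j, of "B + b"] len_F[of j] by (simp add: right_def Q_def)
      qed
      ultimately have "left F j = left F' j" "right F j = right F' j"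
        using X X' lib F i unfolding is_delivery_iff by blast+
      then have "take B (F j) = take B (F' j)" "drop B (F j) = drop B (F' j)"
        using j by (auto simp: left_def right_def)
      then show ?thesis by (metis append_take_drop_id)
    qed
    then have "is_delivery K N (B + B') Q d (L + L') (\<lambda>F. X (left F) @ X' (right F))"
      unfolding is_delivery_iff using len by auto
    then show ?thesis by blast
  qed
  moreover have "Q i j \<subseteq> {..<B + B'}" if "i \<in> {1..K}" "j \<in> {1..N} - init_files K N i" for i j
    using P(1)[OF that] P'(1)[OF that] by (auto simp: Q_def)
  ultimately show ?thesis
    unfolding shuffling_scheme_def using card by blast
qed

lemma shuffling_scheme_mult:
  assumes "shuffling_scheme K N B A L"
  shows "shuffling_scheme K N (n * B) (n * A) (n * L)"
  by (induction n) (simp_all add: shuffling_scheme_0 shuffling_scheme_add assms)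

lemma shuffling_scheme_sum:
  assumes "finite I" "\<And>s. s \<in> I \<Longrightarrow> shuffling_scheme K N (B s) (A s) (L s)"
  shows "shuffling_scheme K N (sum B I) (sum A I) (sum L I)"
  using assms by (induction I) (simp_all add: shuffling_scheme_0 shuffling_scheme_add)

section \<open>The schemes at the corner points\<close>

text \<open>Each subfile is a single bit. Requests are served in \<open>N div K\<close> rounds, one
  file per worker and round, and each round costs one bit for every \<open>s\<close>-set of workers
  avoiding \<open>K\<close>.\<close>

lemma shuffling_scheme_corner:
  assumes "K dvd N" "N \<ge> 1" "s \<in> {1..K}"
  shows "shuffling_scheme K N ((K - 1) choose (s - 1))
    ((N div K) * (s - 1) * ((K - 1) choose (s - 1))) ((N div K) * ((K - 1) choose s))"
proof -
  define q where "q = N div K"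
  define M where "M = (K - 1) choose (s - 1)"
  define own where "own = file_owner K N"
  define subs where "subs j = {G. G \<subseteq> {1..K} - {own j} \<and> card G = s - 1}" for j
  have K: "K \<ge> 1" using assms by auto
  have own: "own j \<in> {1..K}" if "j \<in> {1..N}" for j
    unfolding own_def using assms that by (intro file_owner_bounds)
  have init: "init_files K N i = {j \<in> {1..N}. own j = i}" if "i \<in> {1..K}" for i
    unfolding own_def using assms that by (intro init_files_eq)
  have "\<exists>\<iota>. bij_betw \<iota> (subs j) {..<M}" if "j \<in> {1..N}" for j
  proof (rule finite_same_card_bij)
    show "card (subs j) = card {..<M}"
      using n_subsets[of "{1..K} - {own j}" "s - 1"] own[OF that] by (simp add: subs_def M_def)
  qed (simp_all add: subs_def)
  then obtain \<iota> where \<iota>: "\<And>j. j \<in> {1..N} \<Longrightarrow> bij_betw (\<iota> j) (subs j) {..<M}" by metis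
  \<comment> \<open>Position \<open>\<iota> j G\<close> of file \<open>j\<close> holds subfile
    \<open>G\<close>, and exactly the members of \<open>G\<close> cache it besides the
    owner.\<close>
  define P where "P i j = \<iota> j ` {G \<in> subs j. i \<in> G}" for i j
  have "(\<Sum>j\<in>{1..N} - init_files K N i. card (P i j)) \<le> q * (s - 1) * M" if i: "i \<in> {1..K}" for i
  proof -
    \<comment> \<open>A worker caches at most the fraction \<open>(s - 1) / (K - 1)\<close> of a
      file it does not own; multiplying by \<open>K - 1\<close> keeps the bound in the
      naturals.\<close>
    have card_P: "card (P i j) * (K - 1) \<le> (s - 1) * M" if j: "j \<in> {1..N} - init_files K N i" for j
    proof -
      have *: "i \<in> {1..K} - {own j}" using i j init[OF i] by auto
      have "card (P i j) \<le> card {G \<in> subs j. i \<in> G}"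
        unfolding P_def by (rule card_image_le) (simp add: subs_def)
      also have "{G \<in> subs j. i \<in> G} = {G. G \<subseteq> {1..K} - {own j} \<and> card G = s - 1 \<and> i \<in> G}"
        by (auto simp: subs_def)
      finally have "card (P i j) * (K - 1)
          \<le> card {G. G \<subseteq> {1..K} - {own j} \<and> card G = s - 1 \<and> i \<in> G} * (K - 1)"
        by (rule mult_right_mono) simp
      also have "\<dots> = (s - 1) * M"
        using card_subsets_containing[OF _ *, of "s - 1"] own[of j] j by (simp add: M_def)
      finally show ?thesis .
    qed
    have "card ({1..N} - init_files K N i) = N - q"
      using card_init_files[of K N i] init[OF i] by (subst card_Diff_subset) (auto simp: q_def)
    then have card: "card ({1..N} - init_files K N i) = q * (K - 1)"
      using assms(1) by (auto simp: q_def algebra_simps)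
    show ?thesis
    \<comment> \<open>The factor \<open>K - 1\<close> cannot be cancelled when it is zero, but then
      the only worker owns every file.\<close>
    proof (cases "K = 1")
      case True
      then have "card ({1..N} - init_files K N i) = 0" using card by simp
      then have "{1..N} - init_files K N i = {}" by (simp only: card_0_eq finite_Diff finite_atLeastAtMost)
      then show ?thesis by (simp only: sum.empty)
    next
      case False
      have "(\<Sum>j\<in>{1..N} - init_files K N i. card (P i j)) * (K - 1)
          \<le> card ({1..N} - init_files K N i) * ((s - 1) * M)"
        using sum_bounded_above[of "{1..N} - init_files K N i" "\<lambda>j. card (P i j) * (K - 1)", OF card_P]
        by (simp only: sum_distrib_right of_nat_id)
      also have "\<dots> = q * (s - 1) * M * (K - 1)" by (simp only: card mult_ac)
      finally show ?thesis using False K by simp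
    qed
  qed
  moreover have "P i j \<subseteq> {..<M}" if "i \<in> {1..K}" "j \<in> {1..N} - init_files K N i" for i j
    using \<iota>[of j] that by (auto simp: P_def bij_betw_def)
  moreover have "\<exists>X. is_delivery K N M P d (q * ((K - 1) choose s)) X" if d: "d \<in> assignments K N" for d
  proof -
    have "\<exists>h. bij_betw h {0..<q} (d m)" if "m \<in> {1..K}" for m
    proof -
      have "d m \<subseteq> {1..N}" "card (d m) = q"
        using d that by (auto simp: assignments_def PiE_def Pi_def q_def)
      then show ?thesis using ex_bij_betw_nat_finite[of "d m"] finite_subset by auto
    qed
    \<comment> \<open>In round \<open>r\<close> worker \<open>m\<close> is served the file
      \<open>h m r\<close>.\<close>
    then obtain h where h: "\<And>m. m \<in> {1..K} \<Longrightarrow> bij_betw (h m) {0..<q} (d m)" by metis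
    have h_in: "h m r \<in> {1..N}" if "m \<in> {1..K}" "r < q" for m r
    proof -
      have "h m r \<in> d m" using h[OF that(1)] that by (auto simp: bij_betw_def)
      then show ?thesis using d that by (auto simp: assignments_def PiE_def Pi_def)
    qed
    define v :: "(nat \<Rightarrow> bool list) \<Rightarrow> nat \<Rightarrow> nat set \<Rightarrow> bit"
      where "v F j G = of_bool (F j ! \<iota> j G)" for F j G
    define x where "x F r = boundary {1..K} (multicast own (\<lambda>m. h m r) (v F))" for F r
    define I where "I = {0..<q} \<times> {D. D \<subseteq> {1..K} - {K} \<and> card D = s}"
    have "finite I" by (simp add: I_def)
    then obtain xs where xs: "set xs = I" "distinct xs" using finite_distinct_list by blast
    define X where "X F = map (\<lambda>(r, D). x F r D = 1) xs" for F
    have "length xs = q * ((K - 1) choose s)"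
      using distinct_card[OF xs(2)] xs(1) n_subsets[of "{1..K} - {K}" s] K
      by (simp add: I_def card_cartesian_product)
    then have len: "length (X F) = q * ((K - 1) choose s)" for F by (simp add: X_def)
    have "F j = F' j"
      if l: "l \<in> {1..K}" "j \<in> d l" and F: "F \<in> file_libraries N M" "F' \<in> file_libraries N M"
        and X: "X F = X F'" and cache: "cache_content K N P l F = cache_content K N P l F'" for l j F F'
    \<comment> \<open>A request for a file already owned contributes nothing to
      \<open>multicast\<close> and is answered from the cache.\<close>
    proof (cases "own j = l")
      case True
      have "j \<in> {1..N}" using d l by (auto simp: assignments_def PiE_def Pi_def)
      then show ?thesis using True cache init[OF l(1)] by (auto simp: cache_content_eq_iff)
    next
      case False
      have "j \<in> h l ` {0..<q}" using h[OF l(1)] l(2) by (simp add: bij_betw_def)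
      then obtain r where r: "r < q" "j = h l r" by auto
      have j: "j \<in> {1..N}" using h_in l r by simp
      have known: "v F j' G = v F' j' G"
        if "j' \<in> {1..N}" "G \<in> subs j'" "own j' = l \<or> l \<in> G" for j' G
      proof (cases "own j' = l")
        case True
        then show ?thesis using that cache init[OF l(1)] by (auto simp: cache_content_eq_iff v_def)
      next
        case False
        then have "\<iota> j' G \<in> P l j'" "j' \<in> {1..N} - init_files K N l"
          using that init[OF l(1)] by (auto simp: P_def)
        then show ?thesis using cache by (simp add: cache_content_eq_iff v_def)
      qed
      have sent: "x F r D = x F' r D" if "D \<subseteq> {1..K} - {K}" "card D = s" for D
      proof -
        have "(r, D) \<in> set xs" using xs that r by (simp add: I_def)
        then have "x F r D = 1 \<longleftrightarrow> x F' r D = 1" using X by (auto simp: X_def)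
        then show ?thesis by (metis bit_not_one_iff)
      qed
      \<comment> \<open>Worker \<open>l\<close> fills in the sums for the sets containing
        \<open>K\<close>, which were not sent.\<close>
      have x: "x F r D = x F' r D" if "D \<subseteq> {1..K}" "card D = s" for D
        unfolding x_def
      proof (rule boundary_eqI[where a = K and s = s])
        fix D assume "D \<subseteq> {1..K} - {K}" "card D = s"
        then show "boundary {1..K} (multicast own (\<lambda>m. h m r) (v F)) D
            = boundary {1..K} (multicast own (\<lambda>m. h m r) (v F')) D"
          using sent unfolding x_def by blast
      qed (use that K in auto)
      have sub: "v F j G = v F' j G" if G: "G \<in> subs j" for G
      proof (cases "l \<in> G")
        case True
        then show ?thesis using known j G by simp
      next
        case False
        have "finite G" using G finite_subset[of G "{1..K}"] by (auto simp: subs_def)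
        then have "card (insert l G) = s" using False G assms(3) by (auto simp: subs_def)
        moreover have "insert l G \<subseteq> {1..K}" using G l by (auto simp: subs_def)
        ultimately have eq: "x F r (insert l G) = x F' r (insert l G)" using x by blast
        show ?thesis
          unfolding r(2)
        proof (rule boundary_multicast_decode[OF _ l(1) _ _ _ False eq[unfolded x_def]])
          fix m G' assume "m \<in> {1..K}" "G' \<subseteq> {1..K} - {own (h m r)}" "card G' = card G"
            "own (h m r) = l \<or> l \<in> G'"
          then show "v F (h m r) G' = v F' (h m r) G'"
            using h_in r(1) G by (intro known) (auto simp: subs_def)
        qed (use \<open>own j \<noteq> l\<close> own[OF j] G r in \<open>auto simp: subs_def\<close>)
      qed
      show ?thesis
      proof (rule nth_equalityI)
        show "length (F j) = length (F' j)" using F j by (auto simp: file_libraries_def PiE_iff)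
        fix b assume "b < length (F j)"
        then have "b < M" using F j by (auto simp: file_libraries_def PiE_iff)
        then have "b \<in> \<iota> j ` subs j" using \<iota>[OF j] by (simp add: bij_betw_def)
        then obtain G where "G \<in> subs j" "b = \<iota> j G" by blast
        then show "F j ! b = F' j ! b" using sub[of G] by (simp add: v_def of_bool_def split: if_splits)
      qed
    qed
    then have "is_delivery K N M P d (q * ((K - 1) choose s)) X"
      unfolding is_delivery_iff using len by auto
    then show ?thesis by blast
  qed
  ultimately show ?thesis
    unfolding shuffling_scheme_def q_def M_def by blast
qed

section \<open>From the corner points to their convex hull\<close>

text \<open>Distinct indices give points with distinct first coordinates, so weights on the points
  are weights on the indices.\<close>

lemma convex_hull_graph_finite:
  fixes g :: "nat \<Rightarrow> real"
  assumes "finite I" "(x, y) \<in> convex hull ((\<lambda>s. (real s, g s)) ` I)"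
  obtains u where "\<And>s. s \<in> I \<Longrightarrow> u s \<ge> 0" "sum u I = 1"
    "(\<Sum>s\<in>I. u s * real s) = x" "(\<Sum>s\<in>I. u s * g s) = y"
proof -
  let ?f = "\<lambda>s. (real s, g s)"
  obtain w where w: "\<forall>p\<in>?f ` I. 0 \<le> w p" "sum w (?f ` I) = 1"
      "(\<Sum>p\<in>?f ` I. w p *\<^sub>R p) = (x, y)"
    using assms by (auto simp: convex_hull_finite)
  have inj: "inj_on ?f I" by (auto simp: inj_on_def)
  have "(\<Sum>s\<in>I. w (?f s) *\<^sub>R ?f s) = (x, y)"
    using w(3) by (simp only: sum.reindex[OF inj] o_def)
  from arg_cong[OF this, of fst] arg_cong[OF this, of snd]
  have "(\<Sum>s\<in>I. w (?f s) * real s) = x" "(\<Sum>s\<in>I. w (?f s) * g s) = y"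
    by (simp_all add: fst_sum snd_sum)
  moreover have "(\<Sum>s\<in>I. w (?f s)) = 1"
    using w(2) by (simp only: sum.reindex[OF inj] o_def)
  ultimately show thesis using that[of "\<lambda>s. w (?f s)"] w(1) by auto
qed

text \<open>Rounding the number of copies down for \<open>s > x\<close> and up for \<open>s \<le> x\<close> keeps the mean cache
  size at most \<open>x\<close>.\<close>

lemma achievable_convex_hull:
  assumes "K dvd N" "N \<ge> 1"
    and hull: "(S / (real N / real K), y) \<in> convex hull ((\<lambda>s. (real s, corner_load K N s)) ` {1..K})"
  shows "achievable K N S (\<lambda>d. y)"
  unfolding achievable_def
proof (intro allI impI)
  fix \<epsilon> :: real assume "\<epsilon> > 0"
  define q where "q = N div K"
  define x where "x = S / (real N / real K)"
  define M where "M s = (K - 1) choose (s - 1)" for s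
  define g where "g = corner_load K N"
  have "K \<ge> 1" using assms by (cases K) auto
  have q: "real N / real K = real q" "q > 0"
    using assms \<open>K \<ge> 1\<close> by (auto simp: q_def real_of_nat_div dvd_imp_le)
  have S: "S = x * real q" using q by (simp add: x_def)
  have M: "M s > 0" if "s \<in> {1..K}" for s using that by (auto simp: M_def)
  have g: "real q * real ((K - 1) choose s) = g s * real (M s)" if "s \<in> {1..K}" for s
    using M[OF that] by (simp add: g_def corner_load_def q(1) M_def)
  obtain u where u: "\<And>s. s \<in> {1..K} \<Longrightarrow> u s \<ge> 0" "sum u {1..K} = 1"
    "(\<Sum>s\<in>{1..K}. u s * real s) = x" "(\<Sum>s\<in>{1..K}. u s * g s) = y"
    using convex_hull_graph_finite[OF _ hull] unfolding x_def g_def by blast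
  \<comment> \<open>\<open>C\<close> bounds the effect of rounding on the broadcast length. Rounding
    shortens the files by at most the sum of all \<open>M s\<close>, so this \<open>n\<close>
    guarantees \<open>B \<ge> C / \<epsilon> + 1\<close>.\<close>
  define C where "C = (\<Sum>s\<in>{1..K}. real (M s) * \<bar>g s - y\<bar>)"
  define n where "n = C / \<epsilon> + (\<Sum>s\<in>{1..K}. real (M s)) + 1"
  have "C \<ge> 0" by (simp add: C_def sum_nonneg)
  then have n: "n > 0" using \<open>\<epsilon> > 0\<close> by (simp add: n_def add_nonneg_pos sum_nonneg)
  \<comment> \<open>One copy of corner scheme \<open>s\<close> takes \<open>M s\<close> bits per
    file, so \<open>a s\<close> copies would take exactly the share \<open>u s\<close> of
    \<open>n\<close> bits; \<open>e s\<close> is the rounding error in bits.\<close>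
  define a where "a s = n * u s / real (M s)" for s
  define b where "b s = nat (if real s > x then \<lfloor>a s\<rfloor> else \<lceil>a s\<rceil>)" for s
  define e where "e s = real (b s) * real (M s) - n * u s" for s
  have a: "a s \<ge> 0" "a s * real (M s) = n * u s" if "s \<in> {1..K}" for s
    using u(1)[OF that] n M[OF that] by (auto simp: a_def)
  have e: "\<bar>e s\<bar> \<le> real (M s)" "e s * (real s - x) \<le> 0" if s: "s \<in> {1..K}" for s
  proof -
    have e_eq: "e s = (real (b s) - a s) * real (M s)"
      using a[OF s] by (simp add: e_def algebra_simps)
    have "\<bar>real (b s) - a s\<bar> \<le> 1" using a(1)[OF s] by (auto simp: b_def) linarith+
    then show "\<bar>e s\<bar> \<le> real (M s)"
      unfolding e_eq abs_mult by (simp add: mult_left_le_one_le)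
    show "e s * (real s - x) \<le> 0"
    proof (cases "real s > x")
      case True
      then have "real (b s) \<le> a s" using a(1)[OF s] by (simp add: b_def)
      then show ?thesis using True by (simp add: e_eq mult_nonpos_nonneg)
    next
      case False
      then have "real (b s) \<ge> a s" by (simp add: b_def) linarith
      then show ?thesis using False by (simp add: e_eq mult_nonneg_nonpos)
    qed
  qed
  define B where "B = (\<Sum>s\<in>{1..K}. b s * M s)"
  define A where "A = (\<Sum>s\<in>{1..K}. b s * (q * (s - 1) * M s))"
  define L where "L = (\<Sum>s\<in>{1..K}. b s * (q * ((K - 1) choose s)))"
  have "shuffling_scheme K N B A L"
    unfolding A_def B_def L_def q_def M_def
    by (intro shuffling_scheme_sum shuffling_scheme_mult shuffling_scheme_corner assms) auto
  then obtain P where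
    P: "\<forall>i\<in>{1..K}. (\<forall>j\<in>{1..N} - init_files K N i. P i j \<subseteq> {..<B}) \<and>
          (\<Sum>j\<in>{1..N} - init_files K N i. card (P i j)) \<le> A"
    and X: "\<forall>d\<in>assignments K N. \<exists>X. is_delivery K N B P d L X"
    unfolding shuffling_scheme_def by blast
  have bM: "real (b s) * real (M s) = n * u s + e s" for s by (simp add: e_def)
  have weighted: "(\<Sum>s\<in>{1..K}. real (b s) * real (M s) * f s)
      = n * (\<Sum>s\<in>{1..K}. u s * f s) + (\<Sum>s\<in>{1..K}. e s * f s)" for f :: "nat \<Rightarrow> real"
    by (simp add: bM distrib_right sum.distrib sum_distrib_left mult.assoc)
  have B: "real B = (\<Sum>s\<in>{1..K}. real (b s) * real (M s))" by (simp add: B_def)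
  have "\<bar>\<Sum>s\<in>{1..K}. e s\<bar> \<le> (\<Sum>s\<in>{1..K}. real (M s))"
    by (rule order_trans[OF sum_abs]) (intro sum_mono e)
  then have B_ge: "real B \<ge> C / \<epsilon> + 1"
    using weighted[of "\<lambda>_. 1"] u(2) by (simp add: B n_def)
  moreover have "C / \<epsilon> \<ge> 0" using \<open>C \<ge> 0\<close> \<open>\<epsilon> > 0\<close> by simp
  ultimately have "B > 0" by linarith
  have "real A \<le> (S - real N / real K) * real B"
  proof -
    \<comment> \<open>The excess over the cache budget is a weighted sum of
      \<open>real s - x\<close>. Under the exact weights \<open>u\<close> it vanishes, and the
      rounding errors contribute only nonpositive terms.\<close>
    have "real A - (S - real q) * real B
        = real q * (\<Sum>s\<in>{1..K}. real (b s) * real (M s) * (real s - x))"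
      unfolding A_def B S sum_distrib_left of_nat_sum sum_subtractf[symmetric]
      by (intro sum.cong refl) (auto simp: of_nat_diff algebra_simps)
    also have "(\<Sum>s\<in>{1..K}. real (b s) * real (M s) * (real s - x)) = (\<Sum>s\<in>{1..K}. e s * (real s - x))"
      unfolding weighted using u
      by (simp add: right_diff_distrib sum_subtractf flip: sum_distrib_right)
    also have "real q * \<dots> \<le> 0" by (intro mult_nonneg_nonpos sum_nonpos e) auto
    finally show ?thesis using q(1) by simp
  qed
  then have "uncoded_placement K N S B P"
    unfolding uncoded_placement_def using P by (meson of_nat_le_iff order_trans)
  moreover have "real L / real B \<le> y + \<epsilon>"
  proof -
    \<comment> \<open>Likewise \<open>g s - y\<close> has mean zero under \<open>u\<close>, so only
      the rounding errors remain, at most \<open>C\<close> in total.\<close>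
    have "real L - y * real B = (\<Sum>s\<in>{1..K}. real (b s) * real (M s) * (g s - y))"
      unfolding L_def B sum_distrib_left of_nat_sum sum_subtractf[symmetric]
      using g by (intro sum.cong refl) (simp add: algebra_simps)
    also have "\<dots> = (\<Sum>s\<in>{1..K}. e s * (g s - y))"
      unfolding weighted using u
      by (simp add: right_diff_distrib sum_subtractf flip: sum_distrib_right)
    also have "\<dots> \<le> C"
      unfolding C_def
    proof (rule sum_mono)
      fix s assume "s \<in> {1..K}"
      then have "\<bar>e s\<bar> * \<bar>g s - y\<bar> \<le> real (M s) * \<bar>g s - y\<bar>" using e by (intro mult_right_mono) auto
      then show "e s * (g s - y) \<le> real (M s) * \<bar>g s - y\<bar>"
        using abs_ge_self[of "e s * (g s - y)"] by (simp add: abs_mult)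
    qed
    also have "C \<le> \<epsilon> * real B" using B_ge \<open>\<epsilon> > 0\<close> by (simp add: field_simps)
    finally show ?thesis using \<open>B > 0\<close> by (simp add: field_simps)
  qed
  ultimately show "\<exists>B>0. \<exists>P. uncoded_placement K N S B P \<and>
      (\<forall>d\<in>assignments K N. \<exists>L X. is_delivery K N B P d L X \<and> real L / real B \<le> y + \<epsilon>)"
    using \<open>B > 0\<close> X by (intro exI[of _ B] exI[of _ P] conjI) fast+
qed

theorem theorem4:
  fixes K N :: nat
  assumes "K \<ge> 1" and "N \<ge> 1" and "K dvd N"
  shows "(\<forall>S::real. \<forall>s\<in>{1..K}. S / (real N / real K) = real s \<longrightarrow>
            achievable K N S (\<lambda>d. corner_load K N s)) \<and>
         (\<forall>S::real. 1 \<le> S / (real N / real K) \<and> S / (real N / real K) \<le> real K \<and>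
            S / (real N / real K) \<notin> \<int> \<longrightarrow>
            achievable K N S (\<lambda>d. lower_convex_envelope
              ((\<lambda>s. (real s, corner_load K N s)) ` {1..K}) (S / (real N / real K))))"
proof (intro conjI allI ballI impI)
  fix S :: real and s assume "s \<in> {1..K}" "S / (real N / real K) = real s"
  then show "achievable K N S (\<lambda>d. corner_load K N s)"
    using assms by (intro achievable_convex_hull) (auto intro: hull_inc)
next
  let ?C = "(\<lambda>s. (real s, corner_load K N s)) ` {1..K}"
  fix S :: real
  let ?x = "S / (real N / real K)"
  assume x: "1 \<le> ?x \<and> ?x \<le> real K \<and> ?x \<notin> \<int>"
  \<comment> \<open>The projection of the hull is convex and contains 1 and \<open>K\<close>, so the
    infimum is over a nonempty set.\<close>
  have "?x \<in> fst ` (convex hull ?C)"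
  proof -
    have "convex (fst ` (convex hull ?C))"
      by (intro convex_linear_image convex_convex_hull linear_fst)
    moreover have "real s \<in> fst ` (convex hull ?C)" if "s \<in> {1..K}" for s
      using that by (intro image_eqI[where x = "(real s, corner_load K N s)"]) (auto intro: hull_inc)
    from this[of 1] this[of K] have "1 \<in> fst ` (convex hull ?C)" "real K \<in> fst ` (convex hull ?C)"
      using assms by auto
    ultimately show ?thesis
      using x mem_is_interval_1_I[of "fst ` (convex hull ?C)" 1 "real K" ?x]
      by (auto simp: is_interval_convex_1)
  qed
  then have ne: "{y. (?x, y) \<in> convex hull ?C} \<noteq> {}" by auto
  show "achievable K N S (\<lambda>d. lower_convex_envelope ?C ?x)"
    unfolding achievable_def
  proof (intro allI impI)
    fix \<epsilon> :: real assume "\<epsilon> > 0"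
    \<comment> \<open>Half of \<open>\<epsilon>\<close> pays for the distance of a hull point from
      the infimum, the other half for the scheme at that point.\<close>
    then have "Inf {y. (?x, y) \<in> convex hull ?C} < lower_convex_envelope ?C ?x + \<epsilon> / 2"
      by (simp add: lower_convex_envelope_def)
    then obtain y where y: "(?x, y) \<in> convex hull ?C" "y < lower_convex_envelope ?C ?x + \<epsilon> / 2"
      using cInf_lessD[OF ne] by blast
    have "achievable K N S (\<lambda>d. y)" using achievable_convex_hull y(1) assms by blast
    then obtain B P where "B > 0" "uncoded_placement K N S B P"
      and d: "\<forall>d\<in>assignments K N. \<exists>L X. is_delivery K N B P d L X \<and> real L / real B \<le> y + \<epsilon> / 2"
      using \<open>\<epsilon> > 0\<close> unfolding achievable_def by (meson half_gt_zero)
    moreover have "\<exists>L X. is_delivery K N B P d L X \<and>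
        real L / real B \<le> lower_convex_envelope ?C ?x + \<epsilon>" if assignment: "d \<in> assignments K N" for d
    proof -
      obtain L X where "is_delivery K N B P d L X" "real L / real B \<le> y + \<epsilon> / 2"
        using d assignment by blast
      then show ?thesis using y(2) by (intro exI[of _ L] exI[of _ X]) linarith
    qed
    ultimately show "\<exists>B>0. \<exists>P. uncoded_placement K N S B P \<and>
        (\<forall>d\<in>assignments K N. \<exists>L X. is_delivery K N B P d L X \<and>
           real L / real B \<le> lower_convex_envelope ?C ?x + \<epsilon>)"
      by (intro exI[of _ B] exI[of _ P] conjI) fast+
  qed
qed

end
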